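(* Consider the problem (stochastic program I) of minimizing, over all admissible control policies $\pi=\{(G_i,C_i,D_i): i=1,2,\ldots\}$, the cost $$J_G(\pi,S_1)=\limsup_{n\to\infty}\mathbb{E}\Big[\frac1n\sum_{i=1}^n G_i\Big]$$ where $\Delta_1,\Delta_2,\ldots$ is an arbitrary random process. Then the following stationary policy $\pi^{(1)}=\{(G^{(1)}_i,C^{(1)}_i,D^{(1)}_i)\}$ is optimal, i.e. $J_G(\pi^{(1)},S_1)\le J_G(\pi,S_1)$ for every admissible policy $\pi$: - if $\frac{S_{\max}-S_i}{\alpha_c}\le \Delta_i$: $G_i=0$, $C_i=\frac{S_{\max}-S_i}{\alpha_c}$, $D_i=0$ (so $S_{i+1}=S_{\max}$); - if $0\le\Delta_i<\frac{S_{\max}-S_i}{\alpha_c}$: $G_i=0$, $C_i=\Delta_i$, $D_i=0$ (so $S_{i+1}=S_i+\alpha_c\Delta_i$); - if $-\alpha_d S_i\le\Delta_i<0$: $G_i=0$, $C_i=0$, $D_i=-\Delta_i$ (so $S_{i+1}=S_i+\Delta_i/\alpha_d$); - if $-G_{\max}-\alpha_d S_i\le\Delta_i<-\alpha_d S_i$: $G_i=-\Delta_i-\alpha_d S_i$, $C_i=0$, $D_i=\alpha_d S_i$ (so $S_{i+1}=0$); - if $\Delta_i<-G_{\max}-\alpha_d S_i$: $G_i=G_{\max}$, $C_i=0$, $D_i=\alpha_d S_i$ (so $S_{i+1}=0$).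
   Context: Single-bus power system with storage in slotted time $i=1,2,\ldots$. Constants: charging efficiency $\alpha_c\in(0,1)$, discharging efficiency $\alpha_d\in(0,1)$, conventional generation capacity $G_{\max}\ge 0$, power storage capacity $S_{\max}\ge 0$. The net renewable generation $\Delta_1,\Delta_2,\ldots$ is an exogenous real-valued random process (its law is not affected by the controls). The initial stored power $S_1\in[0,S_{\max}]$ is given. The controls in slot $i$ are the conventional generation $G_i$, the charging power $C_i$ and the discharging power $D_i$. An admissible policy $\pi=\{(G_i,C_i,D_i)\}_{i\ge1}$ chooses $(G_i,C_i,D_i)$ as a (measurable) function of the history $H_i=(S_1,\Delta_1,\ldots,S_{i-1},\Delta_{i-1},S_i)$ and the current $\Delta_i$, such that for all $i$: $$S_{i+1}=S_i+\alpha_c C_i-\frac1{\alpha_d}D_i,\quad 0\le S_i\le S_{\max},\quad C_i\ge0,\quad D_i\ge 0,\quad 0\le G_i\le G_{\max},$$ $$0\le G_i-C_i+D_i+\max\{\Delta_i,-G_{\max}-\alpha_d S_i\}.$$ Charging and discharging rates are otherwise unconstrained. *)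

theory Defs
  imports "HOL-Probability.Probability"
begin

text \<open>
  Slots are numbered from 1.  The information available in slot \<open>i\<close>, that is the history
  \<open>(S\<^sub>1, \<Delta>\<^sub>1, \<dots>, S\<^sub>i\<^sub>-\<^sub>1, \<Delta>\<^sub>i\<^sub>-\<^sub>1, S\<^sub>i)\<close> together with the current \<open>\<Delta>\<^sub>i\<close>, is the pair of the
  storage levels and of the net renewable generations, both restricted to \<open>{1..i}\<close>.
\<close>

type_synonym info = "(nat \<Rightarrow> real) \<times> (nat \<Rightarrow> real)"

definition info_space :: "nat \<Rightarrow> info measure" where
  "info_space i = (\<Pi>\<^sub>M k\<in>{1..i}. borel) \<Otimes>\<^sub>M (\<Pi>\<^sub>M k\<in>{1..i}. borel)"

record policy =
  gen :: "nat \<Rightarrow> info \<Rightarrow> real"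
  charge :: "nat \<Rightarrow> info \<Rightarrow> real"
  discharge :: "nat \<Rightarrow> info \<Rightarrow> real"

lemma restrict_fundef_cong [fundef_cong]:
  assumes "A = B" and "\<And>x. x \<in> B \<Longrightarrow> f x = g x"
  shows "restrict f A = restrict g B"
  using assms by (auto simp: restrict_def)

text \<open>
  The storage level at the start of each slot, for a policy \<open>\<pi>\<close>, an initial level \<open>s\<close> and one
  realisation \<open>\<delta>\<close> of the net renewable generation.  Slot 0 does not exist; its value is a dummy.
\<close>

fun storage :: "real \<Rightarrow> real \<Rightarrow> policy \<Rightarrow> real \<Rightarrow> (nat \<Rightarrow> real) \<Rightarrow> nat \<Rightarrow> real" where
  "storage \<alpha>\<^sub>c \<alpha>\<^sub>d \<pi> s \<delta> 0 = s"
| "storage \<alpha>\<^sub>c \<alpha>\<^sub>d \<pi> s \<delta> (Suc i) =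
    (if i = 0 then s
     else let h = (restrict (\<lambda>k. storage \<alpha>\<^sub>c \<alpha>\<^sub>d \<pi> s \<delta> k) {1..i}, restrict \<delta> {1..i})
          in storage \<alpha>\<^sub>c \<alpha>\<^sub>d \<pi> s \<delta> i + \<alpha>\<^sub>c * charge \<pi> i h - 1 / \<alpha>\<^sub>d * discharge \<pi> i h)"

definition info :: "real \<Rightarrow> real \<Rightarrow> policy \<Rightarrow> real \<Rightarrow> (nat \<Rightarrow> real) \<Rightarrow> nat \<Rightarrow> info" where
  "info \<alpha>\<^sub>c \<alpha>\<^sub>d \<pi> s \<delta> i = (restrict (storage \<alpha>\<^sub>c \<alpha>\<^sub>d \<pi> s \<delta>) {1..i}, restrict \<delta> {1..i})"

definition feasible_slot ::
  "real \<Rightarrow> real \<Rightarrow> real \<Rightarrow> real \<Rightarrow> policy \<Rightarrow> real \<Rightarrow> (nat \<Rightarrow> real) \<Rightarrow> nat \<Rightarrow> bool" where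
  "feasible_slot \<alpha>\<^sub>c \<alpha>\<^sub>d Gmax Smax \<pi> s \<delta> i \<longleftrightarrow>
    (let S = storage \<alpha>\<^sub>c \<alpha>\<^sub>d \<pi> s \<delta> i;
         h = info \<alpha>\<^sub>c \<alpha>\<^sub>d \<pi> s \<delta> i;
         G = gen \<pi> i h; C = charge \<pi> i h; D = discharge \<pi> i h
     in 0 \<le> S \<and> S \<le> Smax \<and> 0 \<le> C \<and> 0 \<le> D \<and> 0 \<le> G \<and> G \<le> Gmax \<and>
        0 \<le> G - C + D + max (\<delta> i) (- Gmax - \<alpha>\<^sub>d * S))"

text \<open>The constraints, being relations between random variables, are required almost surely.\<close>

definition admissible ::
  "real \<Rightarrow> real \<Rightarrow> real \<Rightarrow> real \<Rightarrow> 'w measure \<Rightarrow> (nat \<Rightarrow> 'w \<Rightarrow> real) \<Rightarrow> real \<Rightarrow> policy \<Rightarrow> bool" where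
  "admissible \<alpha>\<^sub>c \<alpha>\<^sub>d Gmax Smax M \<Delta> s \<pi> \<longleftrightarrow>
    (\<forall>i\<ge>1. gen \<pi> i \<in> borel_measurable (info_space i) \<and>
           charge \<pi> i \<in> borel_measurable (info_space i) \<and>
           discharge \<pi> i \<in> borel_measurable (info_space i)) \<and>
    (AE \<omega> in M. \<forall>i\<ge>1. feasible_slot \<alpha>\<^sub>c \<alpha>\<^sub>d Gmax Smax \<pi> s (\<lambda>k. \<Delta> k \<omega>) i)"

definition generation ::
  "real \<Rightarrow> real \<Rightarrow> (nat \<Rightarrow> 'w \<Rightarrow> real) \<Rightarrow> real \<Rightarrow> policy \<Rightarrow> nat \<Rightarrow> 'w \<Rightarrow> real" where
  "generation \<alpha>\<^sub>c \<alpha>\<^sub>d \<Delta> s \<pi> i \<omega> = gen \<pi> i (info \<alpha>\<^sub>c \<alpha>\<^sub>d \<pi> s (\<lambda>k. \<Delta> k \<omega>) i)"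

definition cost ::
  "real \<Rightarrow> real \<Rightarrow> 'w measure \<Rightarrow> (nat \<Rightarrow> 'w \<Rightarrow> real) \<Rightarrow> policy \<Rightarrow> real \<Rightarrow> ereal" where
  "cost \<alpha>\<^sub>c \<alpha>\<^sub>d M \<Delta> \<pi> s =
    limsup (\<lambda>n. ereal (\<integral>\<omega>. (1 / real n) * (\<Sum>i=1..n. generation \<alpha>\<^sub>c \<alpha>\<^sub>d \<Delta> s \<pi> i \<omega>) \<partial>M))"

definition stationary :: "(real \<Rightarrow> real \<Rightarrow> real \<times> real \<times> real) \<Rightarrow> policy" where
  "stationary f =
    \<lparr>gen = (\<lambda>i (S, \<delta>). fst (f (S i) (\<delta> i))),
     charge = (\<lambda>i (S, \<delta>). fst (snd (f (S i) (\<delta> i)))),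
     discharge = (\<lambda>i (S, \<delta>). snd (snd (f (S i) (\<delta> i))))\<rparr>"

text \<open>The triple is \<open>(G, C, D)\<close>, as a function of the storage level and the net generation.\<close>

definition greedy_control ::
  "real \<Rightarrow> real \<Rightarrow> real \<Rightarrow> real \<Rightarrow> real \<Rightarrow> real \<Rightarrow> real \<times> real \<times> real" where
  "greedy_control \<alpha>\<^sub>c \<alpha>\<^sub>d Gmax Smax S \<delta> =
    (if (Smax - S) / \<alpha>\<^sub>c \<le> \<delta> then (0, (Smax - S) / \<alpha>\<^sub>c, 0)
     else if 0 \<le> \<delta> then (0, \<delta>, 0)
     else if - \<alpha>\<^sub>d * S \<le> \<delta> then (0, 0, - \<delta>)
     else if - Gmax - \<alpha>\<^sub>d * S \<le> \<delta> then (- \<delta> - \<alpha>\<^sub>d * S, 0, \<alpha>\<^sub>d * S)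
     else (Gmax, 0, \<alpha>\<^sub>d * S))"

definition greedy_policy :: "real \<Rightarrow> real \<Rightarrow> real \<Rightarrow> real \<Rightarrow> policy" where
  "greedy_policy \<alpha>\<^sub>c \<alpha>\<^sub>d Gmax Smax = stationary (greedy_control \<alpha>\<^sub>c \<alpha>\<^sub>d Gmax Smax)"

lemma storage_greedy_policy:
  fixes \<alpha>\<^sub>c \<alpha>\<^sub>d Gmax Smax s :: real and \<delta> :: "nat \<Rightarrow> real"
  defines "S \<equiv> storage \<alpha>\<^sub>c \<alpha>\<^sub>d (greedy_policy \<alpha>\<^sub>c \<alpha>\<^sub>d Gmax Smax) s \<delta>"
  assumes "0 < \<alpha>\<^sub>c" "0 < \<alpha>\<^sub>d" "1 \<le> i"
  shows "S (Suc i) =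
    (if (Smax - S i) / \<alpha>\<^sub>c \<le> \<delta> i then Smax
     else if 0 \<le> \<delta> i then S i + \<alpha>\<^sub>c * \<delta> i
     else if - \<alpha>\<^sub>d * S i \<le> \<delta> i then S i + \<delta> i / \<alpha>\<^sub>d
     else 0)"
  using assms by (simp add: greedy_policy_def stationary_def greedy_control_def Let_def)

end

theory Submission
  imports Defs
begin

text \<open>
  The comparison is pathwise.  Along every realisation on which a competing policy is feasible, let
  \<open>K\<close> be the generation spent so far by the competitor minus that spent by the greedy policy, and
  let \<open>S\<close>, \<open>T\<close> be their storage levels.  Stored power saves at most \<open>\<alpha>\<^sub>d\<close> units of generation per
  unit, and never hurts, which gives the invariant \<open>K \<ge> \<alpha>\<^sub>d * max 0 (S - T)\<close>.  In particular
  \<open>K \<ge> 0\<close> in every slot, and taking expectations compares the costs for every horizon.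
\<close>

section \<open>A single slot as a map of levels and controls, detached from policies and
  histories\<close>

definition next_level :: "real \<Rightarrow> real \<Rightarrow> real \<Rightarrow> real \<times> real \<times> real \<Rightarrow> real" where
  "next_level \<alpha>\<^sub>c \<alpha>\<^sub>d S u = S + \<alpha>\<^sub>c * fst (snd u) - 1 / \<alpha>\<^sub>d * snd (snd u)"

text \<open>Kept separate from the level bounds, which the comparison of one slot imposes on the
  competitor's next level rather than on its current one.\<close>

definition feasible_control ::
  "real \<Rightarrow> real \<Rightarrow> real \<Rightarrow> real \<Rightarrow> real \<times> real \<times> real \<Rightarrow> bool" where
  "feasible_control \<alpha>\<^sub>d Gmax S \<delta> u \<longleftrightarrow>
    (case u of (G, C, D) \<Rightarrow> 0 \<le> C \<and> 0 \<le> D \<and> 0 \<le> G \<and> G \<le> Gmax \<and>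
      0 \<le> G - C + D + max \<delta> (- Gmax - \<alpha>\<^sub>d * S))"

definition control :: "policy \<Rightarrow> nat \<Rightarrow> info \<Rightarrow> real \<times> real \<times> real" where
  "control \<pi> i h = (gen \<pi> i h, charge \<pi> i h, discharge \<pi> i h)"

lemma feasible_slot_iff:
  "feasible_slot \<alpha>\<^sub>c \<alpha>\<^sub>d Gmax Smax \<pi> s \<delta> i \<longleftrightarrow>
    storage \<alpha>\<^sub>c \<alpha>\<^sub>d \<pi> s \<delta> i \<in> {0..Smax} \<and>
    feasible_control \<alpha>\<^sub>d Gmax (storage \<alpha>\<^sub>c \<alpha>\<^sub>d \<pi> s \<delta> i) (\<delta> i)
      (control \<pi> i (info \<alpha>\<^sub>c \<alpha>\<^sub>d \<pi> s \<delta> i))"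
  by (auto simp: feasible_slot_def feasible_control_def control_def Let_def)

lemma storage_1 [simp]: "storage \<alpha>\<^sub>c \<alpha>\<^sub>d \<pi> s \<delta> (Suc 0) = s"
  by simp

lemma storage_Suc:
  assumes "1 \<le> i"
  shows "storage \<alpha>\<^sub>c \<alpha>\<^sub>d \<pi> s \<delta> (Suc i) =
    next_level \<alpha>\<^sub>c \<alpha>\<^sub>d (storage \<alpha>\<^sub>c \<alpha>\<^sub>d \<pi> s \<delta> i) (control \<pi> i (info \<alpha>\<^sub>c \<alpha>\<^sub>d \<pi> s \<delta> i))"
  using assms by (simp add: next_level_def control_def info_def Let_def)

text \<open>From here on the recursion is unfolded only through \<open>storage_Suc\<close>, so that
  levels do not expand into nested histories.\<close>

declare storage.simps(2) [simp del]

section \<open>Feasibility of the greedy policy\<close>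

lemma control_greedy:
  assumes "1 \<le> i"
  shows "control (greedy_policy \<alpha>\<^sub>c \<alpha>\<^sub>d Gmax Smax) i (info \<alpha>\<^sub>c \<alpha>\<^sub>d \<pi> s \<delta> i) =
    greedy_control \<alpha>\<^sub>c \<alpha>\<^sub>d Gmax Smax (storage \<alpha>\<^sub>c \<alpha>\<^sub>d \<pi> s \<delta> i) (\<delta> i)"
  using assms by (simp add: control_def greedy_policy_def stationary_def info_def)

text \<open>The balance holds because \<open>max\<close> is at least each argument: the first serves
  the first four branches, while the last branch supplies
  \<open>Gmax + \<alpha>\<^sub>d * S\<close>, exactly cancelling the second.\<close>

lemma greedy_control_feasible:
  assumes "0 < \<alpha>\<^sub>c" "0 < \<alpha>\<^sub>d" "0 \<le> Gmax" "S \<in> {0..Smax}"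
  shows "feasible_control \<alpha>\<^sub>d Gmax S \<delta> (greedy_control \<alpha>\<^sub>c \<alpha>\<^sub>d Gmax Smax S \<delta>)"
proof -
  have "0 \<le> (Smax - S) / \<alpha>\<^sub>c" "0 \<le> \<alpha>\<^sub>d * S"
    using assms by auto
  then show ?thesis
    using assms(3) by (auto simp: feasible_control_def greedy_control_def)
qed

lemma next_level_greedy:
  assumes "0 < \<alpha>\<^sub>c" "0 < \<alpha>\<^sub>d"
  shows "next_level \<alpha>\<^sub>c \<alpha>\<^sub>d S (greedy_control \<alpha>\<^sub>c \<alpha>\<^sub>d Gmax Smax S \<delta>) =
    (if (Smax - S) / \<alpha>\<^sub>c \<le> \<delta> then Smax
     else if 0 \<le> \<delta> then S + \<alpha>\<^sub>c * \<delta>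
     else if - \<alpha>\<^sub>d * S \<le> \<delta> then S + \<delta> / \<alpha>\<^sub>d
     else 0)"
  using assms by (simp add: next_level_def greedy_control_def)

lemma next_level_greedy_bounds:
  assumes "0 < \<alpha>\<^sub>c" "0 < \<alpha>\<^sub>d" "S \<in> {0..Smax}"
  shows "next_level \<alpha>\<^sub>c \<alpha>\<^sub>d S (greedy_control \<alpha>\<^sub>c \<alpha>\<^sub>d Gmax Smax S \<delta>) \<in> {0..Smax}"
proof -
  have "S + \<alpha>\<^sub>c * \<delta> \<le> Smax" if "\<not> (Smax - S) / \<alpha>\<^sub>c \<le> \<delta>"
    using that assms(1) by (simp add: field_simps)
  moreover have "0 \<le> S + \<delta> / \<alpha>\<^sub>d" if "- \<alpha>\<^sub>d * S \<le> \<delta>"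
    using that assms(2) by (simp add: field_simps)
  moreover have "\<delta> / \<alpha>\<^sub>d \<le> 0" if "\<not> 0 \<le> \<delta>"
    using that assms(2) by (simp add: field_simps)
  moreover have "0 \<le> \<alpha>\<^sub>c * \<delta>" if "0 \<le> \<delta>"
    using that assms(1) by simp
  ultimately show ?thesis
    unfolding next_level_greedy[OF assms(1,2)] using assms(3) by auto
qed

lemma feasible_greedy:
  assumes "0 < \<alpha>\<^sub>c" "0 < \<alpha>\<^sub>d" "0 \<le> Gmax" "s \<in> {0..Smax}" "1 \<le> i"
  shows "feasible_slot \<alpha>\<^sub>c \<alpha>\<^sub>d Gmax Smax (greedy_policy \<alpha>\<^sub>c \<alpha>\<^sub>d Gmax Smax) s \<delta> i"
proof -
  have "storage \<alpha>\<^sub>c \<alpha>\<^sub>d (greedy_policy \<alpha>\<^sub>c \<alpha>\<^sub>d Gmax Smax) s \<delta> i \<in> {0..Smax}"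
    using assms(5)
  proof (induction i rule: dec_induct)
    case base
    show ?case using assms(4) by simp
  next
    case (step n)
    show ?case
      unfolding storage_Suc[OF step(1)] control_greedy[OF step(1)]
      by (rule next_level_greedy_bounds[OF assms(1,2) step.IH])
  qed
  then show ?thesis
    unfolding feasible_slot_iff control_greedy[OF assms(5)]
    using greedy_control_feasible[OF assms(1-3)] by blast
qed

section \<open>Comparison of the greedy policy with a competitor\<close>

text \<open>
  Charging at rate \<open>\<alpha>\<^sub>c \<le> 1 / \<alpha>\<^sub>d\<close> gains no more than the same amount of discharging costs, so only the
  net power \<open>C - D\<close> matters for an upper bound.
\<close>

lemma next_level_le:
  assumes "0 < \<alpha>\<^sub>c" "\<alpha>\<^sub>c < 1" "0 < \<alpha>\<^sub>d" "\<alpha>\<^sub>d < 1"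
    and "feasible_control \<alpha>\<^sub>d Gmax S \<delta> (G, C, D)"
  defines "P \<equiv> G + max \<delta> (- Gmax - \<alpha>\<^sub>d * S)"
  shows "\<alpha>\<^sub>d * next_level \<alpha>\<^sub>c \<alpha>\<^sub>d S (G, C, D) \<le> \<alpha>\<^sub>d * S + P"
    and "next_level \<alpha>\<^sub>c \<alpha>\<^sub>d S (G, C, D) \<le> S + \<alpha>\<^sub>c * P"
proof -
  \<comment> \<open>\<open>P\<close> bounds the net charge. The first conclusion converts it at the
    rate \<open>1 / \<alpha>\<^sub>d\<close>, the second at \<open>\<alpha>\<^sub>c\<close>; the
    first is tighter for negative \<open>P\<close>, the second for positive
    \<open>P\<close>.\<close>
  have CD: "0 \<le> C" "0 \<le> D" "C - D \<le> P"
    using assms(5) by (auto simp: feasible_control_def P_def)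
  have "\<alpha>\<^sub>d * \<alpha>\<^sub>c \<le> 1"
    using assms by (simp add: mult_le_one)
  then have le: "\<alpha>\<^sub>d * \<alpha>\<^sub>c * C \<le> C" "\<alpha>\<^sub>d * \<alpha>\<^sub>c * D \<le> D"
    using CD by (simp_all add: mult_left_le_one_le assms(1,3) less_imp_le)
  have eq: "\<alpha>\<^sub>d * next_level \<alpha>\<^sub>c \<alpha>\<^sub>d S (G, C, D) = \<alpha>\<^sub>d * S + \<alpha>\<^sub>d * \<alpha>\<^sub>c * C - D"
    using assms(3) by (simp add: next_level_def field_simps)
  show "\<alpha>\<^sub>d * next_level \<alpha>\<^sub>c \<alpha>\<^sub>d S (G, C, D) \<le> \<alpha>\<^sub>d * S + P"
    using eq le(1) CD(3) by linarith
  have "\<alpha>\<^sub>c * D \<le> 1 / \<alpha>\<^sub>d * D"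
    using le(2) assms(3) by (simp add: field_simps)
  moreover have "\<alpha>\<^sub>c * C \<le> \<alpha>\<^sub>c * P + \<alpha>\<^sub>c * D"
    using CD(3) assms(1) by (metis diff_le_eq distrib_left mult_left_mono less_imp_le)
  ultimately show "next_level \<alpha>\<^sub>c \<alpha>\<^sub>d S (G, C, D) \<le> S + \<alpha>\<^sub>c * P"
    by (simp add: next_level_def)
qed

text \<open>Inductive step of the invariant, for an arbitrary lead \<open>K\<close>. While the
  greedy control generates nothing, generating \<open>G\<close> raises the competitor's stored
  advantage by at most \<open>G\<close>, measured in deliverable power. When it does generate, it
  has emptied its storage and covers at most the remaining deficit.\<close>

lemma greedy_advantage_step:
  assumes \<alpha>: "0 < \<alpha>\<^sub>c" "\<alpha>\<^sub>c < 1" "0 < \<alpha>\<^sub>d" "\<alpha>\<^sub>d < 1"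
    and T: "T \<in> {0..Smax}"
    and u: "feasible_control \<alpha>\<^sub>d Gmax S \<delta> u"
    and S': "next_level \<alpha>\<^sub>c \<alpha>\<^sub>d S u \<in> {0..Smax}"
    and K: "\<alpha>\<^sub>d * max 0 (S - T) \<le> K"
  defines "v \<equiv> greedy_control \<alpha>\<^sub>c \<alpha>\<^sub>d Gmax Smax T \<delta>"
  shows "\<alpha>\<^sub>d * max 0 (next_level \<alpha>\<^sub>c \<alpha>\<^sub>d S u - next_level \<alpha>\<^sub>c \<alpha>\<^sub>d T v) \<le> K + fst u - fst v"
proof -
  obtain G C D where u_eq: "u = (G, C, D)" by (cases u)
  define S' where "S' = next_level \<alpha>\<^sub>c \<alpha>\<^sub>d S u"
  define T' where "T' = next_level \<alpha>\<^sub>c \<alpha>\<^sub>d T v"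
  have G: "0 \<le> G" "G \<le> Gmax"
    using u by (auto simp: u_eq feasible_control_def)
  have S'_bounds: "0 \<le> S'" "S' \<le> Smax" "0 \<le> \<alpha>\<^sub>d * S'"
    using S' \<alpha> by (auto simp: S'_def)
  have T'_bounds: "0 \<le> T'"
    using next_level_greedy_bounds[OF \<alpha>(1,3) T] by (simp add: T'_def v_def)
  \<comment> \<open>The invariant is used, and re-established, as two linear inequalities, one for
    each argument of \<open>max\<close>.\<close>
  have "0 \<le> \<alpha>\<^sub>d * max 0 (S - T)" "\<alpha>\<^sub>d * (S - T) \<le> \<alpha>\<^sub>d * max 0 (S - T)"
    using \<alpha> by (auto intro: mult_left_mono)
  then have K0: "0 \<le> K" and KS: "\<alpha>\<^sub>d * S - \<alpha>\<^sub>d * T \<le> K"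
    using K by (auto simp: right_diff_distrib)
  note le = next_level_le[OF \<alpha> u[unfolded u_eq], folded u_eq, folded S'_def]
  have T'_eq: "T' = (if (Smax - T) / \<alpha>\<^sub>c \<le> \<delta> then Smax
     else if 0 \<le> \<delta> then T + \<alpha>\<^sub>c * \<delta>
     else if - \<alpha>\<^sub>d * T \<le> \<delta> then T + \<delta> / \<alpha>\<^sub>d
     else 0)"
    unfolding T'_def v_def by (rule next_level_greedy[OF \<alpha>(1,3)])
  have v_le: "fst v \<le> Gmax"
    using G by (auto simp: v_def greedy_control_def)
  have v0: "fst v = 0" if "- \<alpha>\<^sub>d * T \<le> \<delta>"
    using that by (auto simp: v_def greedy_control_def)
  have "0 \<le> K + G - fst v \<and> \<alpha>\<^sub>d * (S' - T') \<le> K + G - fst v"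
  proof (cases "\<delta> < - Gmax - \<alpha>\<^sub>d * S")
    case True
    \<comment> \<open>The deficit exceeds all that the competitor can supply, so feasibility forces
      full generation and an empty storage; the greedy control spends no more than
      \<open>Gmax\<close>.\<close>
    then have "\<alpha>\<^sub>d * S' \<le> G - Gmax"
      using le(1) by simp
    then have "G = Gmax" "\<alpha>\<^sub>d * S' = 0"
      using G S'_bounds by linarith+
    moreover have "0 \<le> \<alpha>\<^sub>d * T'"
      using T'_bounds \<alpha> by simp
    ultimately show ?thesis
      unfolding right_diff_distrib using K0 v_le by linarith
  next
    case False
    then have le': "\<alpha>\<^sub>d * S' \<le> \<alpha>\<^sub>d * S + G + \<delta>" "S' \<le> S + \<alpha>\<^sub>c * (G + \<delta>)"
      using le by (simp_all add: max_def split: if_splits)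
    have T0: "0 \<le> \<alpha>\<^sub>d * T" "0 \<le> (Smax - T) / \<alpha>\<^sub>c"
      using T \<alpha> by auto
    consider "(Smax - T) / \<alpha>\<^sub>c \<le> \<delta>"
      | "0 \<le> \<delta>" "\<not> (Smax - T) / \<alpha>\<^sub>c \<le> \<delta>"
      | "- \<alpha>\<^sub>d * T \<le> \<delta>" "\<delta> < 0"
      | "\<delta> < - \<alpha>\<^sub>d * T"
      by linarith
    then show ?thesis
    proof cases
      case 1
      \<comment> \<open>The greedy storage ends full, and the competitor's cannot exceed it.\<close>
      then have "\<alpha>\<^sub>d * (S' - T') \<le> 0"
        using S'_bounds \<alpha> by (simp add: T'_eq mult_nonneg_nonpos)
      then show ?thesis
        using 1 T0 v0 K0 G by auto
    next
      case 2
      \<comment> \<open>Both sides receive \<open>\<alpha>\<^sub>c * \<delta>\<close>, which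
        cancels; the competitor's generation reaches its storage only after the charging
        loss.\<close>
      have "\<alpha>\<^sub>d * (S' - T') \<le> \<alpha>\<^sub>d * (S + \<alpha>\<^sub>c * G - T)"
        using 2 le'(2) \<alpha> by (intro mult_left_mono) (auto simp: T'_eq distrib_left)
      moreover have "\<alpha>\<^sub>d * \<alpha>\<^sub>c * G \<le> G"
        using \<alpha> G by (simp add: mult_left_le_one_le mult_le_one less_imp_le)
      ultimately show ?thesis
        using 2 T0 v0 K0 KS G by (auto simp: algebra_simps)
    next
      case 3
      \<comment> \<open>The deficit is drawn from the greedy storage without loss against the bound
        \<open>le'(1)\<close>, so \<open>\<delta>\<close> cancels.\<close>
      have "\<alpha>\<^sub>d * T' = \<alpha>\<^sub>d * T + \<delta>"
        using 3 T0 \<alpha> by (auto simp: T'_eq distrib_left)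
      then show ?thesis
        using 3 v0 K0 KS G le'(1) by (auto simp: right_diff_distrib)
    next
      case 4
      \<comment> \<open>The bound on \<open>fst v\<close> covers both generating branches: in the
        last one \<open>Gmax\<close> lies below the deficit. Nonnegativity of the new lead then
        comes from \<open>0 \<le> \<alpha>\<^sub>d * S'\<close>.\<close>
      then have "T' = 0" "fst v \<le> - \<delta> - \<alpha>\<^sub>d * T"
        using T0 by (auto simp: T'_eq v_def greedy_control_def)
      then show ?thesis
        using K0 KS le'(1) S'_bounds(3) by auto
    qed
  qed
  then show ?thesis
    unfolding S'_def[symmetric] T'_def[symmetric] by (auto simp: u_eq max_def)
qed

lemma gen_eq_fst_control: "gen \<pi> i h = fst (control \<pi> i h)"
  by (simp add: control_def)

text \<open>After \<open>n\<close> slots the relevant levels are those at the start of slot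
  \<open>Suc n\<close>; for \<open>n = 0\<close> both equal \<open>s\<close> and the sums are
  empty.\<close>

lemma greedy_advantage:
  fixes \<alpha>\<^sub>c \<alpha>\<^sub>d Gmax Smax s :: real and \<pi> :: policy and \<delta> :: "nat \<Rightarrow> real"
  assumes \<alpha>: "0 < \<alpha>\<^sub>c" "\<alpha>\<^sub>c < 1" "0 < \<alpha>\<^sub>d" "\<alpha>\<^sub>d < 1"
    and "0 \<le> Gmax" "s \<in> {0..Smax}"
    and feasible: "\<And>i. 1 \<le> i \<Longrightarrow> feasible_slot \<alpha>\<^sub>c \<alpha>\<^sub>d Gmax Smax \<pi> s \<delta> i"
  defines "g \<equiv> greedy_policy \<alpha>\<^sub>c \<alpha>\<^sub>d Gmax Smax"
  shows "\<alpha>\<^sub>d * max 0 (storage \<alpha>\<^sub>c \<alpha>\<^sub>d \<pi> s \<delta> (Suc n) - storage \<alpha>\<^sub>c \<alpha>\<^sub>d g s \<delta> (Suc n))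
    \<le> (\<Sum>i=1..n. gen \<pi> i (info \<alpha>\<^sub>c \<alpha>\<^sub>d \<pi> s \<delta> i)) - (\<Sum>i=1..n. gen g i (info \<alpha>\<^sub>c \<alpha>\<^sub>d g s \<delta> i))"
proof (induction n)
  case 0
  show ?case by simp
next
  case (Suc n)
  have i: "1 \<le> Suc n" by simp
  have g: "feasible_slot \<alpha>\<^sub>c \<alpha>\<^sub>d Gmax Smax g s \<delta> (Suc n)"
    unfolding g_def using assms by (intro feasible_greedy) auto
  \<comment> \<open>The level reached at the end of a slot is bounded by feasibility of the
    following slot.\<close>
  have level: "storage \<alpha>\<^sub>c \<alpha>\<^sub>d \<pi> s \<delta> (Suc (Suc n)) \<in> {0..Smax}"
    using feasible[of "Suc (Suc n)"] by (simp add: feasible_slot_iff)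
  show ?case
    using greedy_advantage_step[OF \<alpha> _ _ _ Suc.IH, of Smax Gmax "\<delta> (Suc n)"
        "control \<pi> (Suc n) (info \<alpha>\<^sub>c \<alpha>\<^sub>d \<pi> s \<delta> (Suc n))"]
      feasible[OF i] g level
    unfolding storage_Suc[OF i] feasible_slot_iff g_def control_greedy[OF i]
      gen_eq_fst_control
    by (simp add: control_greedy[OF i] algebra_simps)
qed

section \<open>Measurability and integrability\<close>

definition measurable_policy :: "policy \<Rightarrow> bool" where
  "measurable_policy \<pi> \<longleftrightarrow>
    (\<forall>i\<ge>1. gen \<pi> i \<in> borel_measurable (info_space i) \<and>
           charge \<pi> i \<in> borel_measurable (info_space i) \<and>
           discharge \<pi> i \<in> borel_measurable (info_space i))"

lemma measurable_info:
  assumes "\<And>k. k \<in> {1..i} \<Longrightarrow> (\<lambda>\<omega>. storage \<alpha>\<^sub>c \<alpha>\<^sub>d \<pi> s (\<lambda>k. \<Delta> k \<omega>) k) \<in> borel_measurable M"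
    and "\<And>k. 1 \<le> k \<Longrightarrow> \<Delta> k \<in> borel_measurable M"
  shows "(\<lambda>\<omega>. info \<alpha>\<^sub>c \<alpha>\<^sub>d \<pi> s (\<lambda>k. \<Delta> k \<omega>) i) \<in> M \<rightarrow>\<^sub>M info_space i"
  unfolding info_def info_space_def
  by (intro measurable_Pair measurable_restrict) (use assms in auto)

text \<open>Strong induction, because the history passed to the controls of a slot contains all
  levels up to that slot.\<close>

lemma measurable_storage:
  assumes \<pi>: "measurable_policy \<pi>"
    and \<Delta>: "\<And>k. 1 \<le> k \<Longrightarrow> \<Delta> k \<in> borel_measurable M"
    and "1 \<le> i"
  shows "(\<lambda>\<omega>. storage \<alpha>\<^sub>c \<alpha>\<^sub>d \<pi> s (\<lambda>k. \<Delta> k \<omega>) i) \<in> borel_measurable M"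
  using assms(3)
proof (induction i rule: less_induct)
  case (less i)
  show ?case
  proof (cases "i = 1")
    case True
    then show ?thesis by simp
  next
    case False
    with less.prems obtain j where j: "i = Suc j" "1 \<le> j"
      by (cases i) auto
    have [measurable]: "(\<lambda>\<omega>. info \<alpha>\<^sub>c \<alpha>\<^sub>d \<pi> s (\<lambda>k. \<Delta> k \<omega>) j) \<in> M \<rightarrow>\<^sub>M info_space j"
      by (rule measurable_info[OF less.IH \<Delta>]) (use j in auto)
    have [measurable]: "charge \<pi> j \<in> borel_measurable (info_space j)"
      "discharge \<pi> j \<in> borel_measurable (info_space j)"
      using \<pi> j(2) by (auto simp: measurable_policy_def)
    have [measurable]: "(\<lambda>\<omega>. storage \<alpha>\<^sub>c \<alpha>\<^sub>d \<pi> s (\<lambda>k. \<Delta> k \<omega>) j) \<in> borel_measurable M"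
      using less.IH[of j] j by simp
    show ?thesis
      unfolding j(1) storage_Suc[OF j(2)] next_level_def control_def fst_conv snd_conv
      by measurable
  qed
qed

lemma measurable_generation:
  assumes "measurable_policy \<pi>" "\<And>k. 1 \<le> k \<Longrightarrow> \<Delta> k \<in> borel_measurable M" "1 \<le> i"
  shows "generation \<alpha>\<^sub>c \<alpha>\<^sub>d \<Delta> s \<pi> i \<in> borel_measurable M"
  unfolding generation_def
  by (rule measurable_compose[OF measurable_info[OF measurable_storage]])
    (use assms in \<open>auto simp: measurable_policy_def\<close>)

lemma measurable_policy_greedy: "measurable_policy (greedy_policy \<alpha>\<^sub>c \<alpha>\<^sub>d Gmax Smax)"
proof -
  \<comment> \<open>The condition \<open>1 \<le> i\<close> puts the current slot into the index set
    \<open>{1..i}\<close>. The greedy control reads only these two coordinates.\<close>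
  have [measurable]: "(\<lambda>h. fst h i) \<in> borel_measurable (info_space i)"
    "(\<lambda>h. snd h i) \<in> borel_measurable (info_space i)" if "1 \<le> i" for i
    using that unfolding info_space_def by (auto intro!: measurable_compose[OF measurable_fst]
      measurable_compose[OF measurable_snd] measurable_component_singleton)
  have "(\<lambda>h. greedy_control \<alpha>\<^sub>c \<alpha>\<^sub>d Gmax Smax (fst h i) (snd h i))
      \<in> info_space i \<rightarrow>\<^sub>M borel \<Otimes>\<^sub>M borel \<Otimes>\<^sub>M borel" if [arith]: "1 \<le> i" for i
    unfolding greedy_control_def by measurable
  then show ?thesis
    unfolding measurable_policy_def greedy_policy_def stationary_def
    by (auto simp: case_prod_unfold intro: measurable_compose[OF _ measurable_fst]
      measurable_compose[OF measurable_compose[OF _ measurable_snd] measurable_fst]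
      measurable_compose[OF measurable_compose[OF _ measurable_snd] measurable_snd])
qed

lemma admissible_iff:
  "admissible \<alpha>\<^sub>c \<alpha>\<^sub>d Gmax Smax M \<Delta> s \<pi> \<longleftrightarrow> measurable_policy \<pi> \<and>
    (AE \<omega> in M. \<forall>i\<ge>1. feasible_slot \<alpha>\<^sub>c \<alpha>\<^sub>d Gmax Smax \<pi> s (\<lambda>k. \<Delta> k \<omega>) i)"
  by (simp add: admissible_def measurable_policy_def)

lemma feasible_slot_gen:
  assumes "feasible_slot \<alpha>\<^sub>c \<alpha>\<^sub>d Gmax Smax \<pi> s (\<lambda>k. \<Delta> k \<omega>) i"
  shows "generation \<alpha>\<^sub>c \<alpha>\<^sub>d \<Delta> s \<pi> i \<omega> \<in> {0..Gmax}"
  using assms by (simp add: feasible_slot_def generation_def Let_def)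

text \<open>Generation is almost surely in \<open>{0..Gmax}\<close>. Integrability makes the
  expectations in \<open>cost\<close> genuine, since the integral of a non-integrable function
  defaults to 0.\<close>

lemma integrable_generation:
  assumes "prob_space M" "\<And>k. 1 \<le> k \<Longrightarrow> \<Delta> k \<in> borel_measurable M"
    and "admissible \<alpha>\<^sub>c \<alpha>\<^sub>d Gmax Smax M \<Delta> s \<pi>" "1 \<le> i"
  shows "integrable M (generation \<alpha>\<^sub>c \<alpha>\<^sub>d \<Delta> s \<pi> i)"
proof -
  interpret prob_space M by fact
  have "AE \<omega> in M. norm (generation \<alpha>\<^sub>c \<alpha>\<^sub>d \<Delta> s \<pi> i \<omega>) \<le> Gmax"
    using assms(3,4) unfolding admissible_iff by (auto dest!: feasible_slot_gen elim!: eventually_mono)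
  then show ?thesis
    using assms by (intro integrable_const_bound measurable_generation) (auto simp: admissible_iff)
qed

theorem theorem1:
  fixes M :: "'w measure" and \<Delta> :: "nat \<Rightarrow> 'w \<Rightarrow> real"
    and \<alpha>\<^sub>c \<alpha>\<^sub>d Gmax Smax S\<^sub>1 :: real
  assumes "0 < \<alpha>\<^sub>c" "\<alpha>\<^sub>c < 1" and "0 < \<alpha>\<^sub>d" "\<alpha>\<^sub>d < 1"
    and "0 \<le> Gmax" and "0 \<le> Smax"
    and "0 \<le> S\<^sub>1" "S\<^sub>1 \<le> Smax"
    and "prob_space M"
    and "\<And>i. 1 \<le> i \<Longrightarrow> \<Delta> i \<in> borel_measurable M"
  shows "admissible \<alpha>\<^sub>c \<alpha>\<^sub>d Gmax Smax M \<Delta> S\<^sub>1 (greedy_policy \<alpha>\<^sub>c \<alpha>\<^sub>d Gmax Smax) \<and>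
    (\<forall>\<pi>. admissible \<alpha>\<^sub>c \<alpha>\<^sub>d Gmax Smax M \<Delta> S\<^sub>1 \<pi> \<longrightarrow>
      cost \<alpha>\<^sub>c \<alpha>\<^sub>d M \<Delta> (greedy_policy \<alpha>\<^sub>c \<alpha>\<^sub>d Gmax Smax) S\<^sub>1 \<le> cost \<alpha>\<^sub>c \<alpha>\<^sub>d M \<Delta> \<pi> S\<^sub>1)"
proof (intro conjI allI impI)
  let ?g = "greedy_policy \<alpha>\<^sub>c \<alpha>\<^sub>d Gmax Smax"
  have S\<^sub>1: "S\<^sub>1 \<in> {0..Smax}"
    using assms by simp
  show g: "admissible \<alpha>\<^sub>c \<alpha>\<^sub>d Gmax Smax M \<Delta> S\<^sub>1 ?g"
    unfolding admissible_iff
    using measurable_policy_greedy feasible_greedy[OF assms(1,3,5) S\<^sub>1] by simp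
  fix \<pi>
  assume \<pi>: "admissible \<alpha>\<^sub>c \<alpha>\<^sub>d Gmax Smax M \<Delta> S\<^sub>1 \<pi>"
  let ?A = "\<lambda>\<pi> n \<omega>. 1 / real n * (\<Sum>i=1..n. generation \<alpha>\<^sub>c \<alpha>\<^sub>d \<Delta> S\<^sub>1 \<pi> i \<omega>)"
  have "AE \<omega> in M. ?A ?g n \<omega> \<le> ?A \<pi> n \<omega>" for n
  proof -
    have "?A ?g n \<omega> \<le> ?A \<pi> n \<omega>"
      if f: "\<forall>i\<ge>1. feasible_slot \<alpha>\<^sub>c \<alpha>\<^sub>d Gmax Smax \<pi> S\<^sub>1 (\<lambda>k. \<Delta> k \<omega>) i" for \<omega>
    \<comment> \<open>For \<open>n = 0\<close> the factor \<open>1 / real n\<close> is 0, still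
      nonnegative, so this horizon is covered as well.\<close>
    proof (rule mult_left_mono)
      let ?S = "\<lambda>\<pi>. storage \<alpha>\<^sub>c \<alpha>\<^sub>d \<pi> S\<^sub>1 (\<lambda>k. \<Delta> k \<omega>) (Suc n)"
      have "0 \<le> \<alpha>\<^sub>d * max 0 (?S \<pi> - ?S ?g)"
        using assms(3) by simp
      also have "\<dots> \<le> (\<Sum>i=1..n. generation \<alpha>\<^sub>c \<alpha>\<^sub>d \<Delta> S\<^sub>1 \<pi> i \<omega>)
          - (\<Sum>i=1..n. generation \<alpha>\<^sub>c \<alpha>\<^sub>d \<Delta> S\<^sub>1 ?g i \<omega>)"
        unfolding generation_def
        by (rule greedy_advantage[OF assms(1-5) S\<^sub>1]) (use f in simp)
      finally show "(\<Sum>i=1..n. generation \<alpha>\<^sub>c \<alpha>\<^sub>d \<Delta> S\<^sub>1 ?g i \<omega>)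
          \<le> (\<Sum>i=1..n. generation \<alpha>\<^sub>c \<alpha>\<^sub>d \<Delta> S\<^sub>1 \<pi> i \<omega>)"
        by simp
    qed simp
    then show ?thesis
      using \<pi> unfolding admissible_iff by (auto elim: eventually_mono)
  qed
  moreover have "integrable M (?A \<pi>' n)" if "admissible \<alpha>\<^sub>c \<alpha>\<^sub>d Gmax Smax M \<Delta> S\<^sub>1 \<pi>'" for \<pi>' n
    using integrable_generation[OF assms(9,10) that]
    by (intro integrable_mult_right integrable_sum) auto
  ultimately have "(\<integral>\<omega>. ?A ?g n \<omega> \<partial>M) \<le> (\<integral>\<omega>. ?A \<pi> n \<omega> \<partial>M)" for n
    using g \<pi> by (intro integral_mono_AE)
  \<comment> \<open>The expected averages are ordered at every single horizon, and the limit
    superior preserves this order whatever the joint law of \<open>\<Delta>\<close>.\<close>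
  then show "cost \<alpha>\<^sub>c \<alpha>\<^sub>d M \<Delta> ?g S\<^sub>1 \<le> cost \<alpha>\<^sub>c \<alpha>\<^sub>d M \<Delta> \<pi> S\<^sub>1"
    unfolding cost_def by (intro Limsup_mono always_eventually) simp
qed

end
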